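(* Let $\mathscr{R}$ be a ratio-covariety and let $X$ be an $\mathscr{R}$-set. Let $\mathscr{R}[X]$ be the intersection of all elements of $\mathscr{R}$ containing $X$. Then $\mathscr{R}[X]$ is the smallest element (with respect to inclusion) of $\mathscr{R}$ containing $X$.
   Context: $\mathbb{N}$ is the set of nonnegative integers. A numerical semigroup is a submonoid $S$ of $(\mathbb{N},+)$ with $\mathbb{N}\setminus S$ finite. Its multiplicity is $\mathrm{m}(S)=\min(S\setminus\{0\})$. If $S\neq\mathbb{N}$, the ratio of $S$ is $\mathrm{r}(S)=\min\{s\in S\mid \mathrm{m}(S)\nmid s\}$ (equivalently, the smallest minimal generator of $S$ different from $\mathrm{m}(S)$). A ratio-covariety is a nonempty family $\mathscr{R}$ of numerical semigroups such that: 1) $\mathscr{R}$ has a minimum with respect to inclusion, denoted $\min(\mathscr{R})$; 2) if $S,T\in\mathscr{R}$ then $S\cap T\in\mathscr{R}$; 3) if $S\in\mathscr{R}$ and $S\neq\min(\mathscr{R})$, then $S\setminus\{\mathrm{r}(S)\}\in\mathscr{R}$ (in particular $\mathrm{r}(S)$ is defined, i.e. $S\neq\mathbb{N}$). A set $X$ is an $\mathscr{R}$-set if $X\cap\min(\mathscr{R})=\emptyset$ and there is $S\in\mathscr{R}$ with $X\subseteq S$. *)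

theory Defs
  imports Main
begin

definition numerical_semigroup :: "nat set \<Rightarrow> bool" where
  "numerical_semigroup S \<longleftrightarrow>
     0 \<in> S \<and> (\<forall>x\<in>S. \<forall>y\<in>S. x + y \<in> S) \<and> finite (UNIV - S)"

definition multiplicity :: "nat set \<Rightarrow> nat" where
  "multiplicity S = (LEAST s. s \<in> S - {0})"

(* Meaningful only for numerical semigroups other than UNIV: for UNIV the multiplicity
   is 1 and no element qualifies, so LEAST returns an unspecified value. *)
definition ratio :: "nat set \<Rightarrow> nat" where
  "ratio S = (LEAST s. s \<in> S \<and> \<not> multiplicity S dvd s)"

definition is_minimum :: "'a set set \<Rightarrow> 'a set \<Rightarrow> bool" where
  "is_minimum F M \<longleftrightarrow> M \<in> F \<and> (\<forall>S\<in>F. M \<subseteq> S)"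

definition minimum :: "'a set set \<Rightarrow> 'a set" where
  "minimum F = (THE M. is_minimum F M)"

(* The conjunct S \<noteq> UNIV expresses that the ratio of S is defined. *)
definition ratio_covariety :: "nat set set \<Rightarrow> bool" where
  "ratio_covariety R \<longleftrightarrow>
     R \<noteq> {} \<and>
     (\<forall>S\<in>R. numerical_semigroup S) \<and>
     (\<exists>M. is_minimum R M) \<and>
     (\<forall>S\<in>R. \<forall>T\<in>R. S \<inter> T \<in> R) \<and>
     (\<forall>S\<in>R. S \<noteq> minimum R \<longrightarrow> S \<noteq> UNIV \<and> S - {ratio S} \<in> R)"

definition covariety_set :: "nat set set \<Rightarrow> nat set \<Rightarrow> bool" where
  "covariety_set R X \<longleftrightarrow> X \<inter> minimum R = {} \<and> (\<exists>S\<in>R. X \<subseteq> S)"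

definition covariety_hull :: "nat set set \<Rightarrow> nat set \<Rightarrow> nat set" where
  "covariety_hull R X = \<Inter> {S \<in> R. X \<subseteq> S}"

end

theory Submission
  imports Defs
begin

text \<open>
  Every member of a ratio-covariety contains its minimum, which is cofinite, so the
  covariety is a finite family. The members containing a given set therefore form a
  finite family closed under binary intersections, and such a family, when nonempty,
  contains its own intersection.
\<close>

text \<open>
  A superset of a cofinite set is determined by its complement, which is one of the
  finitely many subsets of a finite set.
\<close>

lemma finite_supersets_of_cofinite:
  assumes "finite (- M)"
  shows "finite {S. M \<subseteq> S}"
proof (rule finite_subset)
  show "{S. M \<subseteq> S} \<subseteq> uminus ` Pow (- M)"
  proof
    fix S assume "S \<in> {S. M \<subseteq> S}"
    then have "S = - (- S)" and "- S \<in> Pow (- M)"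
      by auto
    then show "S \<in> uminus ` Pow (- M)"
      by (rule image_eqI)
  qed
  show "finite (uminus ` Pow (- M))"
    using assms by simp
qed

lemma finite_ratio_covariety:
  assumes "ratio_covariety R"
  shows "finite R"
proof -
  obtain M where M: "M \<in> R" "\<forall>S\<in>R. M \<subseteq> S"
    using assms by (auto simp: ratio_covariety_def is_minimum_def)
  have "finite (- M)"
    using assms M(1)
    by (auto simp: ratio_covariety_def numerical_semigroup_def Compl_eq_Diff_UNIV)
  moreover have "R \<subseteq> {S. M \<subseteq> S}"
    using M(2) by blast
  ultimately show ?thesis
    using finite_supersets_of_cofinite finite_subset by blast
qed

theorem proposition5p1:
  fixes R :: "nat set set" and X :: "nat set"
  assumes "ratio_covariety R"
    and "covariety_set R X"
  shows "is_minimum {S \<in> R. X \<subseteq> S} (covariety_hull R X)"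
proof -
  let ?F = "{S \<in> R. X \<subseteq> S}"
  have "finite ?F"
    using finite_ratio_covariety[OF assms(1)] by simp
  moreover have "?F \<noteq> {}"
    using assms(2) by (auto simp: covariety_set_def)
  moreover have "S \<inter> T \<in> ?F" if "S \<in> ?F" "T \<in> ?F" for S T
    using assms(1) that by (auto simp: ratio_covariety_def)
  ultimately have "\<Inter> ?F \<in> ?F"
    by (rule finite_Inf_in)
  then show ?thesis
    unfolding is_minimum_def covariety_hull_def by (simp add: Inter_lower)
qed

end
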